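(* Let $1<p<\infty$, $\beta\in\mathbb{R}$, and set $\theta:=\operatorname{dist}(\beta,\mathbb{Z})\in[0,\tfrac12]$. Let $$\lambda(\beta,p):=\inf_{\substack{u\in W^{1,p}(0,2\pi)\setminus\{0\}\\ u(0)=u(2\pi)}}\frac{\int_0^{2\pi}|\partial_\varphi u+i\beta u|^p\,d\varphi}{\int_0^{2\pi}|u|^p\,d\varphi}.$$ Then $$\left(\frac{\sin(\pi\theta)}{\pi}\right)^{p}\le\lambda(\beta,p)\le\theta^{p}.$$ In particular, $$\left(\frac{2}{\pi}\right)^{p}\operatorname{dist}(\beta,\mathbb{Z})^{p}\le\lambda(\beta,p)\le\operatorname{dist}(\beta,\mathbb{Z})^{p}.$$
   Context: $W^{1,p}(0,2\pi)$ is the Sobolev space of complex-valued functions on the interval $(0,2\pi)$; its elements have continuous representatives on $[0,2\pi]$, so the values $u(0)$ and $u(2\pi)$ are well defined. $\operatorname{dist}(\beta,\mathbb{Z})=\min_{n\in\mathbb{Z}}|\beta-n|$. *)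

theory Defs
  imports "HOL-Analysis.Analysis"
begin

definition smooth_fun :: "(real \<Rightarrow> complex) \<Rightarrow> bool" where
  "smooth_fun \<phi> \<longleftrightarrow>
     (\<forall>k x. ((\<lambda>f y. vector_derivative f (at y)) ^^ k) \<phi> differentiable at x)"

definition test_fun :: "real set \<Rightarrow> (real \<Rightarrow> complex) \<Rightarrow> bool" where
  "test_fun \<Omega> \<phi> \<longleftrightarrow> smooth_fun \<phi> \<and>
     compact (closure {x. \<phi> x \<noteq> 0}) \<and> closure {x. \<phi> x \<noteq> 0} \<subseteq> \<Omega>"

text \<open>Elements of Lebesgue and Sobolev spaces are handled through arbitrary
  representatives; equality of elements is equality almost everywhere on \<open>\<Omega>\<close>.\<close>

definition Lp_fun :: "real \<Rightarrow> real set \<Rightarrow> (real \<Rightarrow> complex) set" where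
  "Lp_fun p \<Omega> = {u. u \<in> borel_measurable (lebesgue_on \<Omega>) \<and>
                     integrable (lebesgue_on \<Omega>) (\<lambda>x. norm (u x) powr p)}"

definition has_weak_derivative_on ::
    "(real \<Rightarrow> complex) \<Rightarrow> (real \<Rightarrow> complex) \<Rightarrow> real set \<Rightarrow> bool" where
  "has_weak_derivative_on u g \<Omega> \<longleftrightarrow>
     (\<forall>K. compact K \<and> K \<subseteq> \<Omega> \<longrightarrow>
        u absolutely_integrable_on K \<and> g absolutely_integrable_on K) \<and>
     (\<forall>\<phi>. test_fun \<Omega> \<phi> \<longrightarrow>
        (LINT x|lebesgue_on \<Omega>. u x * vector_derivative \<phi> (at x)) =
        - (LINT x|lebesgue_on \<Omega>. g x * \<phi> x))"

definition W1p :: "real \<Rightarrow> real set \<Rightarrow> (real \<Rightarrow> complex) set" where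
  "W1p p \<Omega> = {u \<in> Lp_fun p \<Omega>. \<exists>g \<in> Lp_fun p \<Omega>. has_weak_derivative_on u g \<Omega>}"

text \<open>The boundary values of \<open>u\<close> are those of its continuous representative on \<open>{a..b}\<close>.\<close>

definition equal_boundary_values :: "real \<Rightarrow> real \<Rightarrow> (real \<Rightarrow> complex) \<Rightarrow> bool" where
  "equal_boundary_values a b u \<longleftrightarrow>
     (\<exists>w. continuous_on {a..b} w \<and> (AE x in lebesgue_on {a<..<b}. w x = u x) \<and> w a = w b)"

text \<open>In the following set \<open>g\<close> is the weak derivative of \<open>u\<close>, which is unique up to null sets.\<close>

definition rayleigh_quotients :: "real \<Rightarrow> real \<Rightarrow> real set" where
  "rayleigh_quotients \<beta> p =
     {(LINT x|lebesgue_on {0<..<2*pi}. norm (g x + \<i> * of_real \<beta> * u x) powr p) /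
      (LINT x|lebesgue_on {0<..<2*pi}. norm (u x) powr p) | u g.
        u \<in> W1p p {0<..<2*pi} \<and>
        g \<in> Lp_fun p {0<..<2*pi} \<and> has_weak_derivative_on u g {0<..<2*pi} \<and>
        \<not> (AE x in lebesgue_on {0<..<2*pi}. u x = 0) \<and>
        equal_boundary_values 0 (2*pi) u}"

definition lambda_inf :: "real \<Rightarrow> real \<Rightarrow> real" where
  "lambda_inf \<beta> p = Inf (rayleigh_quotients \<beta> p)"

end

theory Submission
  imports Defs
begin

text \<open>The function \<open>u = exp (- \<i> n x)\<close>, with \<open>n\<close> an integer nearest to \<open>\<beta>\<close>, gives the upper bound.
  For the lower bound, the gauge transform \<open>v = exp (\<i> \<beta> x) u\<close> satisfies \<open>\<bar>v\<bar> = \<bar>u\<bar>\<close> and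
  \<open>\<bar>v'\<bar> = \<bar>u' + \<i> \<beta> u\<bar>\<close>, and periodicity of \<open>u\<close> becomes \<open>v(2\<pi>) = \<omega> v(0)\<close> with
  \<open>\<omega> = exp (2 \<pi> \<i> \<beta>)\<close>. Hence
  \<open>(\<omega> - 1) v(x) = \<omega> (v(x) - v(0)) + (v(2\<pi>) - v(x))\<close>, so that
  \<open>2 sin (\<pi> \<theta>) \<bar>v(x)\<bar> \<le> \<integral> \<bar>v'\<bar>\<close> for every \<open>x\<close>; take \<open>p\<close>-th powers, integrate over \<open>x\<close> and use
  Jensen's inequality. The increments of \<open>v\<close> are integrals of \<open>v'\<close>: test the weak derivative
  against smooth approximations of the indicator functions of intervals.\<close>

section \<open>Smooth functions\<close>

text \<open>A set that contains a derivative of each of its members contains all their iterated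
  derivatives, so smoothness reduces to a single differentiation step. The closure proofs below only
  have to exhibit a suitable \<open>S\<close>.\<close>

lemma smooth_fun_coinduct:
  assumes "f \<in> S"
    and step: "\<And>f. f \<in> S \<Longrightarrow> \<exists>f'\<in>S. \<forall>x. (f has_vector_derivative f' x) (at x)"
  shows "smooth_fun f"
proof -
  define D :: "(real \<Rightarrow> complex) \<Rightarrow> real \<Rightarrow> complex"
    where "D = (\<lambda>f y. vector_derivative f (at y))"
  have D: "D f \<in> S" if f: "f \<in> S" for f
  proof -
    obtain f' where "f' \<in> S" and *: "\<And>x. (f has_vector_derivative f' x) (at x)"
      using step[OF f] by blast
    moreover have "D f = f'"
      unfolding D_def by (intro ext vector_derivative_at *)
    ultimately show ?thesis by simp
  qed
  have "(D ^^ k) f \<in> S" for k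
    by (induction k) (auto simp: assms(1) D)
  then have "(D ^^ k) f differentiable at x" for k x
    using step by (meson has_vector_derivative_def differentiable_def)
  then show ?thesis
    unfolding smooth_fun_def D_def by blast
qed

lemma smooth_fun_has_vector_derivative:
  assumes "smooth_fun f"
  shows "(f has_vector_derivative vector_derivative f (at x)) (at x)"
proof -
  have "f differentiable at x"
    using assms[unfolded smooth_fun_def, rule_format, of 0 x] by simp
  then show ?thesis
    by (simp add: vector_derivative_works)
qed

lemma smooth_fun_vector_derivative:
  assumes "smooth_fun f"
  shows "smooth_fun (\<lambda>x. vector_derivative f (at x))"
  unfolding smooth_fun_def
proof (intro allI)
  fix k x
  show "((\<lambda>f y. vector_derivative f (at y)) ^^ k) (\<lambda>x. vector_derivative f (at x)) differentiable at x"
    using assms[unfolded smooth_fun_def, rule_format, of "Suc k" x]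
    by (simp only: funpow_Suc_right o_apply)
qed

lemma smooth_funE:
  assumes "smooth_fun f"
  obtains f' where "smooth_fun f'" "\<And>x. (f has_vector_derivative f' x) (at x)"
  using assms smooth_fun_has_vector_derivative smooth_fun_vector_derivative by blast

lemma smooth_fun_continuous_on:
  assumes "smooth_fun f"
  shows "continuous_on A f"
proof -
  obtain f' where "\<And>x. (f has_vector_derivative f' x) (at x)"
    using smooth_funE[OF assms] by blast
  then show ?thesis
    by (meson continuous_at_imp_continuous_on has_vector_derivative_continuous)
qed

text \<open>Meant for functions given as integrals: from the first derivative on only smooth
  functions occur, so all of these together with \<open>f\<close> form an invariant set.\<close>

lemma smooth_fun_antiderivative:
  assumes "smooth_fun f'" "\<And>x. (f has_vector_derivative f' x) (at x)"
  shows "smooth_fun f"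
proof (rule smooth_fun_coinduct[where S = "insert f (Collect smooth_fun)"])
  fix g assume "g \<in> insert f (Collect smooth_fun)"
  then have "\<exists>g'. smooth_fun g' \<and> (\<forall>x. (g has_vector_derivative g' x) (at x))"
    using assms smooth_funE by (metis insertE mem_Collect_eq)
  then show "\<exists>g'\<in>insert f (Collect smooth_fun). \<forall>x. (g has_vector_derivative g' x) (at x)"
    by blast
qed auto

lemma smooth_fun_add:
  assumes "smooth_fun f" "smooth_fun g"
  shows "smooth_fun (\<lambda>x. f x + g x)"
proof (rule smooth_fun_coinduct[where S = "{\<lambda>x. f x + g x |f g. smooth_fun f \<and> smooth_fun g}"])
  fix h assume "h \<in> {\<lambda>x. f x + g x |f g. smooth_fun f \<and> smooth_fun g}"
  then obtain f g where h: "h = (\<lambda>x. f x + g x)" "smooth_fun f" "smooth_fun g"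
    by blast
  obtain f' where "smooth_fun f'" "\<And>x. (f has_vector_derivative f' x) (at x)"
    using smooth_funE[OF h(2)] by blast
  moreover obtain g' where "smooth_fun g'" "\<And>x. (g has_vector_derivative g' x) (at x)"
    using smooth_funE[OF h(3)] by blast
  ultimately show "\<exists>h'\<in>{\<lambda>x. f x + g x |f g. smooth_fun f \<and> smooth_fun g}.
      \<forall>x. (h has_vector_derivative h' x) (at x)"
    unfolding h(1)
    by (intro bexI[of _ "\<lambda>x. f' x + g' x"] allI has_vector_derivative_add) blast+
qed (use assms in blast)

text \<open>By Leibniz' rule the span of all products of smooth functions is closed under
  differentiation, although the set of products itself is not.\<close>

inductive_set product_span :: "(real \<Rightarrow> complex) set" where
  mult: "smooth_fun f \<Longrightarrow> smooth_fun g \<Longrightarrow> (\<lambda>x. f x * g x) \<in> product_span"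
| add: "f \<in> product_span \<Longrightarrow> g \<in> product_span \<Longrightarrow> (\<lambda>x. f x + g x) \<in> product_span"

lemma smooth_fun_mult:
  assumes "smooth_fun f" "smooth_fun g"
  shows "smooth_fun (\<lambda>x. f x * g x)"
proof (rule smooth_fun_coinduct[where S = product_span])
  fix h assume "h \<in> product_span"
  then show "\<exists>h'\<in>product_span. \<forall>x. (h has_vector_derivative h' x) (at x)"
  proof induction
    case (mult f g)
    obtain f' where f': "smooth_fun f'" "\<And>x. (f has_vector_derivative f' x) (at x)"
      using smooth_funE[OF mult(1)] by blast
    obtain g' where g': "smooth_fun g'" "\<And>x. (g has_vector_derivative g' x) (at x)"
      using smooth_funE[OF mult(2)] by blast
    show ?case
      using mult f' g'
      by (intro bexI[of _ "\<lambda>x. f x * g' x + f' x * g x"] allI has_vector_derivative_mult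
          product_span.intros)
  next
    case (add f g)
    then obtain f' g' where "f' \<in> product_span" "\<And>x. (f has_vector_derivative f' x) (at x)"
      "g' \<in> product_span" "\<And>x. (g has_vector_derivative g' x) (at x)"
      by blast
    then show ?case
      by (intro bexI[of _ "\<lambda>x. f' x + g' x"] allI has_vector_derivative_add
          product_span.intros)
  qed
qed (use assms in \<open>rule product_span.mult\<close>)

lemma smooth_fun_const: "smooth_fun (\<lambda>_. c)"
  by (rule smooth_fun_coinduct[where S = "range (\<lambda>c _. c)"])
    (auto intro!: exI[of _ 0])

lemma smooth_fun_diff:
  assumes "smooth_fun f" "smooth_fun g"
  shows "smooth_fun (\<lambda>x. f x - g x)"
  using smooth_fun_add[OF assms(1) smooth_fun_mult[OF smooth_fun_const[of "-1"] assms(2)]]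
  by simp

lemma smooth_fun_affine:
  assumes "smooth_fun f"
  shows "smooth_fun (\<lambda>x. f (a * x + b))"
proof -
  \<comment> \<open>The chain rule yields a factor \<open>a\<close>, so the invariant set has to
    admit constant multiples; the factor 1 puts the given function into it.\<close>
  have "smooth_fun (\<lambda>x. 1 * f (a * x + b))"
  proof (rule smooth_fun_coinduct[where S = "{\<lambda>x. c * f (a * x + b) |c f. smooth_fun f}"])
    fix h assume "h \<in> {\<lambda>x. c * f (a * x + b) |c f. smooth_fun f}"
    then obtain c f where h: "h = (\<lambda>x. c * f (a * x + b))" "smooth_fun f"
      by blast
    obtain f' where f': "smooth_fun f'" "\<And>x. (f has_vector_derivative f' x) (at x)"
      using smooth_funE[OF h(2)] by blast
    have "((\<lambda>x. f (a * x + b)) has_vector_derivative a *\<^sub>R f' (a * x + b)) (at x)" for x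
      by (rule vector_diff_chain_at[where g = f and f = "\<lambda>x. a * x + b", unfolded o_def])
        (auto intro!: derivative_eq_intros f' simp flip: has_real_derivative_iff_has_vector_derivative)
    then have "(h has_vector_derivative c * (a *\<^sub>R f' (a * x + b))) (at x)" for x
      unfolding h(1) by (rule has_vector_derivative_mult_right)
    then have "(h has_vector_derivative (c * of_real a) * f' (a * x + b)) (at x)" for x
      by (simp add: scaleR_conv_of_real mult.assoc)
    then show "\<exists>h'\<in>{\<lambda>x. c * f (a * x + b) |c f. smooth_fun f}.
        \<forall>x. (h has_vector_derivative h' x) (at x)"
      using f'(1) by (intro bexI[of _ "\<lambda>x. (c * of_real a) * f' (a * x + b)"]) auto
  qed (use assms in blast)
  then show ?thesis by simp
qed

lemma has_vector_derivative_exp_linear: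
  fixes c :: complex
  shows "((\<lambda>x::real. exp (c * of_real x)) has_vector_derivative c * exp (c * of_real x)) (at x)"
  by (rule has_vector_derivative_real_field[of "\<lambda>z. exp (c * z)"])
    (auto intro!: derivative_eq_intros)

lemma smooth_fun_exp_linear:
  fixes c :: complex
  shows "smooth_fun (\<lambda>x. exp (c * of_real x))"
proof -
  let ?S = "range (\<lambda>d x. d * exp (c * of_real x))"
  have "smooth_fun (\<lambda>x. 1 * exp (c * of_real x))"
  proof (rule smooth_fun_coinduct[where S = ?S])
    fix f assume "f \<in> ?S"
    then obtain d where f: "f = (\<lambda>x. d * exp (c * of_real x))"
      by blast
    have "(f has_vector_derivative (d * c) * exp (c * of_real x)) (at x)" for x
      unfolding f mult.assoc
      by (intro has_vector_derivative_mult_right has_vector_derivative_exp_linear)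
    then show "\<exists>f'\<in>?S. \<forall>x. (f has_vector_derivative f' x) (at x)"
      by (intro bexI[of _ "\<lambda>x. (d * c) * exp (c * of_real x)"]) auto
  qed (rule rangeI)
  then show ?thesis by simp
qed

section \<open>A smooth step function\<close>

text \<open>The flat function exp(-1/x), extended by 0, times a polynomial in 1/x. Carrying the
  polynomial as a parameter makes the family closed under differentiation.\<close>

definition exp_inverse_poly :: "real poly \<Rightarrow> real \<Rightarrow> real" where
  "exp_inverse_poly q x = (if x > 0 then poly q (1 / x) * exp (- (1 / x)) else 0)"

lemma poly_times_exp_minus_tendsto_0:
  "((\<lambda>y::real. poly q y * exp (- y)) \<longlongrightarrow> 0) at_top"
proof -
  have "((\<lambda>y. \<Sum>i\<le>degree q. coeff q i * (y ^ i / exp y)) \<longlongrightarrow> (\<Sum>i\<le>degree q. coeff q i * 0)) at_top"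
    by (intro tendsto_intros tendsto_power_div_exp_0)
  then show ?thesis
    by (simp add: poly_altdef sum_distrib_right exp_minus divide_inverse mult.assoc)
qed

text \<open>With y = 1/x one has d/dx = -y^2 d/dy, and -y^2 (q(y) exp(-y))' = y^2 (q - q')(y)
  exp(-y), which explains the new polynomial. At the origin the exponential decay beats every power
  of 1/x, so the derivative there is 0.\<close>

lemma exp_inverse_poly_has_real_derivative:
  "(exp_inverse_poly q has_real_derivative exp_inverse_poly (monom 1 2 * (q - pderiv q)) x) (at x)"
proof -
  consider "x > 0" | "x < 0" | "x = 0" by linarith
  then show ?thesis
  proof cases
    case 1
    have "((\<lambda>x. poly q (1 / x) * exp (- (1 / x))) has_real_derivative
        exp_inverse_poly (monom 1 2 * (q - pderiv q)) x) (at x)"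
      using 1
      by (auto intro!: derivative_eq_intros DERIV_chain'[OF _ poly_DERIV]
          simp: exp_inverse_poly_def poly_monom field_simps power2_eq_square)
    then show ?thesis
      by (rule has_field_derivative_transform_within_open[where S = "{0<..}"])
        (use 1 in \<open>auto simp: exp_inverse_poly_def\<close>)
  next
    case 2
    have "((\<lambda>_. 0) has_real_derivative exp_inverse_poly (monom 1 2 * (q - pderiv q)) x) (at x)"
      using 2 by (auto simp: exp_inverse_poly_def)
    then show ?thesis
      by (rule has_field_derivative_transform_within_open[where S = "{..<0}"])
        (use 2 in \<open>auto simp: exp_inverse_poly_def\<close>)
  next
    case 3
    have "((\<lambda>h. exp_inverse_poly q h / h) \<longlongrightarrow> 0) (at_left 0)"
      by (rule tendsto_eventually) (auto simp: exp_inverse_poly_def eventually_at_filter)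
    moreover have "((\<lambda>h. exp_inverse_poly q h / h) \<longlongrightarrow> 0) (at_right 0)"
    proof -
      \<comment> \<open>Dividing by \<open>h\<close> multiplies by y = \<open>inverse h\<close>,
        whence the factor \<open>[:0, 1:]\<close>; as \<open>h\<close> falls to 0, y tends to
        infinity.\<close>
      have "((\<lambda>h. poly ([:0, 1:] * q) (inverse h) * exp (- inverse h)) \<longlongrightarrow> 0) (at_right 0)"
        by (rule filterlim_compose[OF poly_times_exp_minus_tendsto_0 filterlim_inverse_at_top_right])
      then show ?thesis
        by (rule Lim_transform_eventually)
          (auto simp: exp_inverse_poly_def eventually_at_filter field_simps)
    qed
    ultimately have "((\<lambda>h. exp_inverse_poly q h / h) \<longlongrightarrow> 0) (at 0)"
      by (simp add: filterlim_split_at)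
    then show ?thesis
      using 3 by (simp add: DERIV_def exp_inverse_poly_def)
  qed
qed

lemma smooth_fun_exp_inverse_poly: "smooth_fun (\<lambda>x. of_real (exp_inverse_poly q x))"
  by (rule smooth_fun_coinduct[where S = "range (\<lambda>q x. of_real (exp_inverse_poly q x))"])
    (auto intro!: has_vector_derivative_of_real[OF exp_inverse_poly_has_real_derivative])

text \<open>Rescaling serves two ends: \<open>R (n * (t - x))\<close> approximates the indicator of
  t > x, and its derivative \<open>n * r (n * (t - x))\<close> is an approximate identity living on
  [x, x + 1/n].\<close>

locale smooth_step =
  fixes R r :: "real \<Rightarrow> real"
  assumes R_deriv: "(R has_real_derivative r t) (at t)"
    and r_nonneg: "0 \<le> r t"
    and r_eq_0: "t \<notin> {0..1} \<Longrightarrow> r t = 0"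
    and r_cont: "continuous_on UNIV r"
    and R_eq_0: "t \<le> 0 \<Longrightarrow> R t = 0"
    and R_eq_1: "1 \<le> t \<Longrightarrow> R t = 1"
    and R_smooth: "smooth_fun (\<lambda>t. of_real (R t))"

text \<open>Take the bump exp(-1/t) exp(-1/(1-t)) on (0,1), integrate it, and divide by its total
  mass \<open>S 1\<close>.\<close>

lemma smooth_step_exists: "\<exists>R r. smooth_step R r"
proof -
  define s where "s t = exp_inverse_poly 1 t * exp_inverse_poly 1 (1 - t)" for t
  \<comment> \<open>Starting at -1 rather than 0 keeps every t >= 0 interior to
    \<open>{-1..t+1}\<close>, so the fundamental theorem gives a two-sided derivative also at
    0.\<close>
  define S where "S t = integral {-1..t} s" for t
  have s_nonneg: "0 \<le> s t" for t
    by (auto simp: s_def exp_inverse_poly_def)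
  have s_zero: "s t = 0" if "t \<le> 0 \<or> t \<ge> 1" for t
    using that by (auto simp: s_def exp_inverse_poly_def)
  have smooth: "smooth_fun (\<lambda>t. of_real (s t))"
    using smooth_fun_mult[OF smooth_fun_exp_inverse_poly[of 1]
        smooth_fun_affine[OF smooth_fun_exp_inverse_poly[of 1], of "-1" 1]]
    by (simp add: s_def)
  have cont: "continuous_on A s" for A
    using continuous_on_Re[OF smooth_fun_continuous_on[OF smooth]] by simp
  have S_zero: "S t = 0" if "t \<le> 0" for t
    unfolding S_def using that integral_cong[of "{-1..t}" s "\<lambda>_. 0"] by (simp add: s_zero)
  have S_deriv: "(S has_real_derivative s t) (at t)" for t
  proof (cases "t < 0")
    case True
    have "((\<lambda>_. 0) has_real_derivative s t) (at t)"
      using True by (simp add: s_zero)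
    then show ?thesis
      by (rule has_field_derivative_transform_within_open[where S = "{..<0}"])
        (use True in \<open>auto simp: S_zero\<close>)
  next
    case False
    have "(S has_real_derivative s t) (at t within {-1..t+1})"
      unfolding S_def by (rule integral_has_real_derivative) (use False in \<open>auto intro: cont\<close>)
    then show ?thesis
      using False at_within_Icc_at[of "-1" t "t + 1"] by simp
  qed
  have S_cont: "continuous_on A S" for A
    by (meson DERIV_isCont S_deriv continuous_at_imp_continuous_on)
  have s_pos: "0 < s t" if "0 < t" "t < 1" for t
    using that by (simp add: s_def exp_inverse_poly_def)
  have "S 0 < S 1"
    by (rule DERIV_pos_imp_increasing_open[OF zero_less_one _ S_cont]) (use S_deriv s_pos in blast)
  then have pos: "0 < S 1"
    by (simp add: S_zero)
  have S_one: "S t = S 1" if "1 \<le> t" for t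
  proof (cases "t = 1")
    case False
    show ?thesis
      by (rule DERIV_isconst2[OF _ S_cont DERIV_cong[OF S_deriv s_zero], of 1 t])
        (use that False in auto)
  qed simp
  have "smooth_step (\<lambda>t. S t / S 1) (\<lambda>t. s t / S 1)"
  proof
    show deriv: "((\<lambda>t. S t / S 1) has_real_derivative s t / S 1) (at t)" for t
      by (rule DERIV_cdivide[OF S_deriv])
    have "smooth_fun (\<lambda>t. of_real (1 / S 1) * of_real (s t))"
      by (rule smooth_fun_mult[OF smooth_fun_const smooth])
    then have "smooth_fun (\<lambda>t. of_real (s t / S 1))"
      by simp
    then show "smooth_fun (\<lambda>t. of_real (S t / S 1))"
      by (rule smooth_fun_antiderivative) (rule has_vector_derivative_of_real[OF deriv])
    show "continuous_on UNIV (\<lambda>t. s t / S 1)"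
      using pos by (intro continuous_on_divide cont continuous_on_const) simp
    show "S t / S 1 = 1" if "1 \<le> t" for t
      using pos S_one[OF that] by simp
  qed (use pos in \<open>auto simp: s_nonneg s_zero S_zero\<close>)
  then show ?thesis by blast
qed

section \<open>Integrability over open intervals\<close>

lemma continuous_imp_integrable_open_interval:
  fixes f :: "real \<Rightarrow> complex"
  assumes "continuous_on {a..b} f"
  shows "integrable (lebesgue_on {a<..<b}) f"
proof -
  have "set_integrable lebesgue {a<..<b} f"
    by (rule set_integrable_subset[OF absolutely_integrable_continuous_real[OF assms]]) auto
  then show ?thesis
    by (simp add: integrable_restrict_space set_integrable_def)
qed

text \<open>Continuity up to the endpoints makes \<open>f\<close> bounded, so a multiple of
  \<open>u\<close> dominates the product.\<close>

lemma integrable_mult_continuous: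
  fixes f u :: "real \<Rightarrow> complex"
  assumes u: "integrable (lebesgue_on {a<..<b}) u" and f: "continuous_on {a..b} f"
  shows "integrable (lebesgue_on {a<..<b}) (\<lambda>x. u x * f x)"
proof -
  have "bounded (f ` {a..b})"
    by (intro compact_imp_bounded compact_continuous_image f compact_Icc)
  then obtain B where B: "\<And>x. x \<in> {a..b} \<Longrightarrow> norm (f x) \<le> B"
    unfolding bounded_iff by blast
  show ?thesis
  proof (rule Bochner_Integration.integrable_bound)
    show "integrable (lebesgue_on {a<..<b}) (\<lambda>x. of_real B * u x)"
      using u by simp
    show "(\<lambda>x. u x * f x) \<in> borel_measurable (lebesgue_on {a<..<b})"
      using u continuous_imp_integrable_open_interval[OF f] by (intro borel_measurable_times) auto
    have "norm (u x * f x) \<le> norm (of_real B * u x)" if "x \<in> {a<..<b}" for x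
    proof -
      have "norm (f x) \<le> B" using that B[of x] by auto
      then have "norm (f x) \<le> \<bar>B\<bar>" by linarith
      then show ?thesis
        by (simp add: norm_mult mult.commute mult_right_mono)
    qed
    then show "AE x in lebesgue_on {a<..<b}. norm (u x * f x) \<le> norm (of_real B * u x)"
      by (intro AE_I2) auto
  qed
qed

section \<open>Rescaled steps and the approximate identity they generate\<close>

context smooth_step
begin

lemma R_bounds: "0 \<le> R t" "R t \<le> 1"
proof -
  have mono: "R s \<le> R t" if "s \<le> t" for s t
    by (rule DERIV_nonneg_imp_nondecreasing[OF that]) (use R_deriv r_nonneg in blast)
  show "0 \<le> R t"
    using mono[of "min t 0" t] by (simp add: R_eq_0)
  show "R t \<le> 1"
    using mono[of t "max t 1"] by (simp add: R_eq_1)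
qed

lemma R_scaled_has_vector_derivative:
  "((\<lambda>t. complex_of_real (R (n * (t - x)))) has_vector_derivative of_real (n * r (n * (t - x)))) (at t)"
proof (rule has_vector_derivative_of_real)
  show "((\<lambda>t. R (n * (t - x))) has_real_derivative n * r (n * (t - x))) (at t)"
    by (rule DERIV_cong[OF DERIV_chain'[OF _ R_deriv]]) (auto intro!: derivative_eq_intros)
qed

lemma R_scaled_smooth: "smooth_fun (\<lambda>t. complex_of_real (R (n * (t - x))))"
  using smooth_fun_affine[OF R_smooth, of n "- n * x"] by (simp add: algebra_simps)

lemma r_scaled_continuous_on: "continuous_on A (\<lambda>t. complex_of_real (n * r (n * (t - x))))"
  by (intro continuous_intros continuous_on_compose2[OF r_cont]) auto

text \<open>For large n the kernels are nonnegative, have mass 1 on the interval and live on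
  [x, x + 1/n], so the integral is an average of values of \<open>v\<close> near x.\<close>

lemma r_scaled_concentrates:
  fixes v :: "real \<Rightarrow> complex"
  assumes v: "continuous_on {a..b} v" and x: "a < x" "x < b"
  shows "(\<lambda>n. LINT t|lebesgue_on {a<..<b}. v t * of_real (real n * r (real n * (t - x)))) \<longlonglongrightarrow> v x"
proof (rule LIMSEQ_I)
  fix e :: real assume "e > 0"
  let ?M = "lebesgue_on {a<..<b}"
  have "isCont v x"
    using continuous_on_interior[OF v] x by simp
  then obtain d where d: "d > 0" "\<And>t. dist t x < d \<Longrightarrow> dist (v t) (v x) < e / 2"
    using \<open>e > 0\<close> unfolding continuous_at_eps_delta by (metis half_gt_zero)
  \<comment> \<open>For such n, 1/n is below \<open>d\<close>, so the support stays within the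
    continuity radius, and below \<open>b - x\<close>, so the whole mass of the kernel falls inside
    the interval.\<close>
  obtain N :: nat where N: "1 / min d (b - x) < real N"
    using reals_Archimedean2 by blast
  have "norm ((LINT t|?M. v t * of_real (real n * r (real n * (t - x)))) - v x) < e"
    if "n \<ge> N" for n
  proof -
    define k where "k t = real n * r (real n * (t - x))" for t
    have pos: "0 < min d (b - x)" using d(1) x by simp
    have "1 / min d (b - x) < real n"
      using N that by (meson le_less_trans less_le_trans of_nat_le_iff order_less_le_trans)
    then have n: "1 < real n * min d (b - x)"
      using pos by (simp add: divide_simps)
    have npos: "0 < real n"
      using n pos by (smt (verit) mult_nonneg_nonpos2 mult_nonpos_nonneg)
    have nd: "1 < real n * d" and nb: "1 < real n * (b - x)"
      using n npos by (smt (verit) mult_left_mono min.cobounded1 min.cobounded2)+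
    have k_nonneg: "0 \<le> k t" for t
      by (simp add: k_def r_nonneg)
    have k_cont: "continuous_on A (\<lambda>t. complex_of_real (k t))" for A
      unfolding k_def by (rule r_scaled_continuous_on)
    have k_int: "integrable ?M (\<lambda>t. complex_of_real (k t))"
      by (rule continuous_imp_integrable_open_interval[OF k_cont])
    have vk_int: "integrable ?M (\<lambda>t. v t * of_real (k t))"
      by (rule integrable_mult_continuous[OF continuous_imp_integrable_open_interval[OF v] k_cont])
    have "((\<lambda>t. complex_of_real (k t)) has_integral
        of_real (R (real n * (b - x))) - of_real (R (real n * (a - x)))) {a..b}"
      unfolding k_def
      using x
      by (intro fundamental_theorem_of_calculus
          has_vector_derivative_at_within[OF R_scaled_has_vector_derivative]) auto
    moreover have "R (real n * (b - x)) = 1"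
      using nb by (intro R_eq_1) simp
    moreover have "R (real n * (a - x)) = 0"
      using x by (intro R_eq_0) (simp add: mult_nonneg_nonpos)
    ultimately have "((\<lambda>t. complex_of_real (k t)) has_integral 1) {a..b}"
      by simp
    then have k1: "(LINT t|?M. complex_of_real (k t)) = 1"
      using lebesgue_integral_eq_integral[OF k_int]
      by (simp add: has_integral_Icc_iff_Ioo integral_unique)
    then have k1': "(LINT t|?M. k t) = 1"
      by simp
    have k_int': "integrable ?M k"
      using k_int by (simp add: complex_of_real_integrable_eq)
    have "(LINT t|?M. v t * of_real (k t)) - v x = (LINT t|?M. v t * of_real (k t)) - (LINT t|?M. v x * of_real (k t))"
      using k1 by simp
    also have "\<dots> = (LINT t|?M. v t * of_real (k t) - v x * of_real (k t))"
      using vk_int k_int by (subst Bochner_Integration.integral_diff) auto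
    finally have eq: "(LINT t|?M. v t * of_real (k t)) - v x = (LINT t|?M. v t * of_real (k t) - v x * of_real (k t))" .
    \<comment> \<open>Off the support of the kernel both sides vanish; on it 0 <= t - x < d and the
      continuity estimate applies.\<close>
    have bound: "norm (v t * of_real (k t) - v x * of_real (k t)) \<le> e / 2 * k t" for t
    proof (cases "real n * (t - x) \<in> {0..1}")
      case False
      then show ?thesis using r_eq_0[of "real n * (t - x)"] by (simp add: k_def)
    next
      case True
      then have "0 \<le> t - x" using npos by (auto simp: zero_le_mult_iff)
      moreover have "real n * (t - x) < real n * d" using True nd by auto
      then have "t - x < d" using npos by simp
      ultimately have "dist (v t) (v x) < e / 2"
        by (intro d(2)) (simp add: dist_real_def)
      then have "norm (v t - v x) * k t \<le> e / 2 * k t"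
        by (intro mult_right_mono k_nonneg) (simp add: dist_norm)
      then show ?thesis
        using k_nonneg[of t] by (simp add: norm_mult flip: left_diff_distrib)
    qed
    have "norm (LINT t|?M. v t * of_real (k t) - v x * of_real (k t)) \<le> (LINT t|?M. e / 2 * k t)"
      by (rule Bochner_Integration.integral_norm_bound_integral)
        (use bound k_int' vk_int k_int in auto)
    also have "\<dots> < e"
      using k1' \<open>e > 0\<close> by simp
    finally show ?thesis
      unfolding eq[symmetric] unfolding k_def .
  qed
  then show "\<exists>no. \<forall>n\<ge>no. norm ((LINT t|?M. v t * of_real (real n * r (real n * (t - x)))) - v x) < e"
    by blast
qed

text \<open>At t = x the limit is 0, since \<open>R\<close> vanishes at 0. This is why differences
  of two steps converge to indicators of half-open intervals \<open>{x<..y}\<close>.\<close>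

lemma R_scaled_tendsto: "(\<lambda>n. R (real n * (t - x))) \<longlonglongrightarrow> (if x < t then 1 else 0)"
proof (cases "x < t")
  case True
  obtain N :: nat where "1 / (t - x) < real N"
    using reals_Archimedean2 by blast
  then have "1 \<le> real n * (t - x)" if "n \<ge> N" for n
  proof -
    have "1 / (t - x) \<le> real n"
      using \<open>1 / (t - x) < real N\<close> that by linarith
    then show ?thesis using True by (simp add: divide_simps)
  qed
  then have "\<forall>\<^sub>F n in sequentially. R (real n * (t - x)) = 1"
    using R_eq_1 eventually_sequentially by blast
  then show ?thesis
    using True by (simp add: tendsto_eventually)
qed (simp add: R_eq_0 mult_nonneg_nonpos)

text \<open>Left of x both steps are 0, and right of y + 1/n both are 1, so they cancel there. The
  last hypothesis places y + 1/n before b.\<close>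

lemma test_fun_R_difference:
  assumes "a < x" "x \<le> y" "0 < n" "1 < n * (b - y)"
  shows "test_fun {a<..<b} (\<lambda>t. complex_of_real (R (n * (t - x))) - of_real (R (n * (t - y))))"
    (is "test_fun _ ?f")
proof -
  have zero: "?f t = 0" if "t \<notin> {x..y + 1 / n}" for t
  proof (cases "t < x")
    case True
    then show ?thesis
      using assms by (simp add: R_eq_0 mult_nonneg_nonpos)
  next
    case False
    then have "1 \<le> n * (t - y)"
      using that assms by (simp add: field_simps)
    moreover from this have "1 \<le> n * (t - x)"
      using assms by (smt (verit) mult_left_mono)
    ultimately show ?thesis
      by (simp add: R_eq_1)
  qed
  have "closure {t. ?f t \<noteq> 0} \<subseteq> {x..y + 1 / n}"
    by (rule closure_minimal) (use zero in blast, rule closed_atLeastAtMost)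
  moreover have "{x..y + 1 / n} \<subseteq> {a<..<b}"
  proof -
    have "y + 1 / n < b" using assms by (simp add: field_simps)
    then show ?thesis using assms by auto
  qed
  moreover have "smooth_fun ?f"
    by (intro smooth_fun_diff R_scaled_smooth)
  ultimately show ?thesis
    unfolding test_fun_def compact_closure
    by (meson bounded_closed_interval bounded_subset closure_subset order_trans)
qed

end

section \<open>Weak derivatives and increments\<close>

text \<open>Test against the difference of the steps at x and y. Its derivative is a difference of
  two approximate identities, so the left side tends to \<open>v x - v y\<close>. The test functions
  are bounded by 1 and tend to the indicator of \<open>{x<..y}\<close>, so the right side converges
  by dominated convergence with majorant \<open>norm (h t)\<close>.\<close>

lemma (in smooth_step) weak_derivative_imp_increment_aux:
  fixes v h :: "real \<Rightarrow> complex"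
  assumes v: "continuous_on {a..b} v" and h: "integrable (lebesgue_on {a<..<b}) h"
    and weak: "\<And>\<phi>. test_fun {a<..<b} \<phi> \<Longrightarrow>
        (LINT t|lebesgue_on {a<..<b}. v t * vector_derivative \<phi> (at t)) =
        - (LINT t|lebesgue_on {a<..<b}. h t * \<phi> t)"
    and xy: "a < x" "x \<le> y" "y < b"
  shows "v y - v x = (LINT t|lebesgue_on {a<..<b}. h t * of_real (indicator {x<..y} t))"
proof -
  let ?M = "lebesgue_on {a<..<b}"
  define k where "k n z t = complex_of_real (real n * r (real n * (t - z)))" for n z t
  define \<phi> where
    "\<phi> n t = complex_of_real (R (real n * (t - x))) - complex_of_real (R (real n * (t - y)))" for n t
  have vk: "integrable ?M (\<lambda>t. v t * k n z t)" for n z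
    unfolding k_def
    by (intro integrable_mult_continuous continuous_imp_integrable_open_interval v
        r_scaled_continuous_on)
  have \<phi>_deriv: "vector_derivative (\<phi> n) (at t) = k n x t - k n y t" for n t
    unfolding \<phi>_def k_def
    by (intro vector_derivative_at has_vector_derivative_diff R_scaled_has_vector_derivative)
  have "(\<lambda>n. (LINT t|?M. v t * k n x t) - (LINT t|?M. v t * k n y t)) \<longlonglongrightarrow> v x - v y"
    unfolding k_def using xy by (intro tendsto_diff r_scaled_concentrates v) auto
  then have lim1: "(\<lambda>n. LINT t|?M. v t * vector_derivative (\<phi> n) (at t)) \<longlonglongrightarrow> v x - v y"
    using vk by (simp add: \<phi>_deriv right_diff_distrib)
  have lim2: "(\<lambda>n. LINT t|?M. h t * \<phi> n t) \<longlonglongrightarrow> (LINT t|?M. h t * of_real (indicator {x<..y} t))"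
  proof (rule integral_dominated_convergence)
    have \<phi>_cont: "continuous_on A (\<phi> n)" for A n
      unfolding \<phi>_def by (intro smooth_fun_continuous_on smooth_fun_diff R_scaled_smooth)
    show "(\<lambda>t. h t * \<phi> n t) \<in> borel_measurable ?M" for n
      using integrable_mult_continuous[OF h \<phi>_cont] by (rule borel_measurable_integrable)
    show "integrable ?M (\<lambda>t. norm (h t))"
      using h by simp
    show "AE t in ?M. norm (h t * \<phi> n t) \<le> norm (h t)" for n
    proof (intro AE_I2)
      fix t
      have "norm (\<phi> n t) \<le> 1"
        using R_bounds[of "real n * (t - x)"] R_bounds[of "real n * (t - y)"]
        unfolding \<phi>_def of_real_diff[symmetric] norm_of_real by linarith
      then show "norm (h t * \<phi> n t) \<le> norm (h t)"
        by (simp add: norm_mult mult_left_le)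
    qed
    show "AE t in ?M. (\<lambda>n. h t * \<phi> n t) \<longlonglongrightarrow> h t * of_real (indicator {x<..y} t)"
    proof (intro AE_I2)
      fix t
      have "(\<lambda>n. \<phi> n t) \<longlonglongrightarrow>
          complex_of_real (if x < t then 1 else 0) - complex_of_real (if y < t then 1 else 0)"
        unfolding \<phi>_def by (intro tendsto_diff tendsto_of_real R_scaled_tendsto)
      also have "complex_of_real (if x < t then 1 else 0) - complex_of_real (if y < t then 1 else 0)
          = of_real (indicator {x<..y} t)"
        using xy by (auto simp: indicator_def)
      finally show "(\<lambda>n. h t * \<phi> n t) \<longlonglongrightarrow> h t * of_real (indicator {x<..y} t)"
        by (intro tendsto_mult tendsto_const)
    qed
    have "(\<lambda>t. complex_of_real (indicator {x<..y} t)) \<in> borel_measurable ?M"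
      using xy by (intro measurable_compose[OF borel_measurable_indicator borel_measurable_of_real])
        (auto simp: sets_restrict_space_iff)
    then show "(\<lambda>t. h t * of_real (indicator {x<..y} t)) \<in> borel_measurable ?M"
      using h by (intro borel_measurable_times) auto
  qed
  \<comment> \<open>Only once 1/n < b - y is the difference of steps supported inside the open
    interval; the weak identity for all large n suffices in the limit.\<close>
  obtain N :: nat where N: "1 / (b - y) < real N"
    using reals_Archimedean2 by blast
  have "(LINT t|?M. v t * vector_derivative (\<phi> n) (at t)) = - (LINT t|?M. h t * \<phi> n t)"
    if "n \<ge> N" for n
  proof (rule weak)
    have "1 / (b - y) < real n" using N that by linarith
    moreover from this have "0 < real n"
      using xy by (smt (verit) divide_pos_pos)
    ultimately show "test_fun {a<..<b} (\<phi> n)"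
      unfolding \<phi>_def using xy by (intro test_fun_R_difference) (auto simp: field_simps)
  qed
  then have "\<forall>\<^sub>F n in sequentially.
      (LINT t|?M. v t * vector_derivative (\<phi> n) (at t)) = - (LINT t|?M. h t * \<phi> n t)"
    using eventually_sequentially by blast
  then have "(\<lambda>n. - (LINT t|?M. h t * \<phi> n t)) \<longlonglongrightarrow> v x - v y"
    using lim1 tendsto_cong by fastforce
  from LIMSEQ_unique[OF this tendsto_minus[OF lim2]] show ?thesis
    by (simp add: algebra_simps)
qed

lemma weak_derivative_imp_increment:
  fixes v h :: "real \<Rightarrow> complex"
  assumes "continuous_on {a..b} v" and "integrable (lebesgue_on {a<..<b}) h"
    and "\<And>\<phi>. test_fun {a<..<b} \<phi> \<Longrightarrow>
        (LINT t|lebesgue_on {a<..<b}. v t * vector_derivative \<phi> (at t)) =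
        - (LINT t|lebesgue_on {a<..<b}. h t * \<phi> t)"
    and "a < x" "x \<le> y" "y < b"
  shows "v y - v x = (LINT t|lebesgue_on {a<..<b}. h t * of_real (indicator {x<..y} t))"
proof -
  obtain R r where "smooth_step R r"
    using smooth_step_exists by blast
  then show ?thesis
    using assms by (rule smooth_step.weak_derivative_imp_increment_aux)
qed

section \<open>Product rule for weak derivatives\<close>

lemma test_fun_mult_smooth:
  assumes "test_fun \<Omega> \<phi>" "smooth_fun e"
  shows "test_fun \<Omega> (\<lambda>x. e x * \<phi> x)"
proof -
  have "closure {x. e x * \<phi> x \<noteq> 0} \<subseteq> closure {x. \<phi> x \<noteq> 0}"
    by (intro closure_mono) auto
  moreover have "bounded {x. e x * \<phi> x \<noteq> 0}"
    using assms(1) unfolding test_fun_def compact_closure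
    by (elim conjE bounded_subset) auto
  ultimately show ?thesis
    using assms smooth_fun_mult unfolding test_fun_def compact_closure by blast
qed

text \<open>The product of \<open>e\<close> and \<phi> is again a test function. Testing
  \<open>u\<close> against it and expanding its derivative by Leibniz' rule moves \<open>e\<close>
  from the test function to \<open>u\<close>.\<close>

lemma weak_derivative_mult_smooth:
  fixes u g e e' :: "real \<Rightarrow> complex"
  assumes u: "integrable (lebesgue_on {a<..<b}) u" and g: "integrable (lebesgue_on {a<..<b}) g"
    and weak: "has_weak_derivative_on u g {a<..<b}"
    and e: "smooth_fun e" "\<And>x. (e has_vector_derivative e' x) (at x)" "continuous_on {a..b} e'"
    and \<phi>: "test_fun {a<..<b} \<phi>"
  shows "(LINT t|lebesgue_on {a<..<b}. u t * e t * vector_derivative \<phi> (at t)) =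
    - (LINT t|lebesgue_on {a<..<b}. (g t * e t + u t * e' t) * \<phi> t)"
proof -
  let ?M = "lebesgue_on {a<..<b}"
  define \<phi>' where "\<phi>' t = vector_derivative \<phi> (at t)" for t
  have smooth: "smooth_fun \<phi>" using \<phi> by (simp add: test_fun_def)
  have \<phi>': "(\<phi> has_vector_derivative \<phi>' t) (at t)" for t
    unfolding \<phi>'_def by (rule smooth_fun_has_vector_derivative[OF smooth])
  have cont: "continuous_on A e" "continuous_on A \<phi>" "continuous_on A \<phi>'" for A
    unfolding \<phi>'_def using smooth e smooth_fun_vector_derivative smooth_fun_continuous_on by blast+
  have "vector_derivative (\<lambda>x. e x * \<phi> x) (at t) = e t * \<phi>' t + e' t * \<phi> t" for t
    by (intro vector_derivative_at has_vector_derivative_mult e \<phi>')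
  moreover have "(LINT t|?M. u t * vector_derivative (\<lambda>x. e x * \<phi> x) (at t)) =
      - (LINT t|?M. g t * (e t * \<phi> t))"
    using weak test_fun_mult_smooth[OF \<phi> e(1)] unfolding has_weak_derivative_on_def by blast
  ultimately have eq: "(LINT t|?M. u t * (e t * \<phi>' t + e' t * \<phi> t)) = - (LINT t|?M. g t * (e t * \<phi> t))"
    by simp
  have i1: "integrable ?M (\<lambda>t. u t * (e t * \<phi>' t))"
    by (intro integrable_mult_continuous u continuous_on_mult cont)
  have i2: "integrable ?M (\<lambda>t. u t * (e' t * \<phi> t))"
    by (intro integrable_mult_continuous u continuous_on_mult cont e)
  have i3: "integrable ?M (\<lambda>t. g t * (e t * \<phi> t))"
    by (intro integrable_mult_continuous g continuous_on_mult cont)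
  have "(LINT t|?M. u t * (e t * \<phi>' t)) =
      - (LINT t|?M. g t * (e t * \<phi> t)) - (LINT t|?M. u t * (e' t * \<phi> t))"
    using eq i1 i2 by (simp add: distrib_left eq_diff_eq)
  moreover have "(LINT t|?M. g t * (e t * \<phi> t) + u t * (e' t * \<phi> t)) =
      (LINT t|?M. g t * (e t * \<phi> t)) + (LINT t|?M. u t * (e' t * \<phi> t))"
    by (rule Bochner_Integration.integral_add[OF i3 i2])
  ultimately show ?thesis
    unfolding \<phi>'_def distrib_right mult.assoc by simp
qed

section \<open>Inequalities\<close>

text \<open>Jensen's inequality for the p-th power by way of Young's inequality: with m the mean of
  f and q the conjugate exponent, f m^(p-1) <= f^p / p + m^p / q pointwise. Integration makes the
  left side c m^p.\<close>

lemma Jensen_powr: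
  fixes f :: "'a \<Rightarrow> real"
  assumes "finite_measure M" "1 < p"
    and f: "integrable M f" "\<And>x. 0 \<le> f x" "integrable M (\<lambda>x. f x powr p)"
    and c: "c = measure M (space M)" "0 < c"
  shows "c * ((LINT x|M. f x) / c) powr p \<le> (LINT x|M. f x powr p)"
proof -
  interpret finite_measure M by fact
  define m where "m = (LINT x|M. f x) / c"
  define q where "q = p / (p - 1)"
  have m: "0 \<le> m" "(LINT x|M. f x) = c * m"
    using c f by (auto simp: m_def integral_nonneg_AE)
  have q: "1 < q" "1 / p + 1 / q = 1"
    using \<open>1 < p\<close> by (auto simp: q_def field_simps)
  \<comment> \<open>Since 1/q = 1 - 1/p, this lets the m^p terms on both sides be combined, leaving
    c m^p / p on the left.\<close>
  have q_eq: "z / q = z - z / p" for z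
    using \<open>1 < p\<close> by (simp add: q_def field_simps)
  have young: "f x * m powr (p - 1) \<le> f x powr p / p + m powr p / q" for x
  proof -
    have "(m powr (p - 1)) powr q = m powr p"
      using \<open>1 < p\<close> by (simp add: powr_powr q_def)
    then show ?thesis
      using Youngs_inequality[OF \<open>1 < p\<close> q f(2), of "m powr (p - 1)" x] by simp
  qed
  have "(LINT x|M. f x * m powr (p - 1)) \<le> (LINT x|M. f x powr p / p + m powr p / q)"
    by (rule integral_mono) (use f young in auto)
  moreover have "m * m powr (p - 1) = m powr p"
    using m \<open>1 < p\<close> by (cases "m = 0") (auto simp: powr_diff)
  ultimately have "c * m powr p \<le> (LINT x|M. f x powr p) / p + c * m powr p / q"
    using f m c by (simp add: mult.assoc)
  then have "c * m powr p / p \<le> (LINT x|M. f x powr p) / p"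
    unfolding q_eq by linarith
  then show ?thesis
    using \<open>1 < p\<close> by (simp add: m_def divide_le_cancel)
qed

lemma finite_measure_lebesgue_on_Ioo: "finite_measure (lebesgue_on {a<..<b::real})"
  using lmeasurable_box[of a b] by (intro finite_measure_lebesgue_on) simp

text \<open>On a finite measure space the constant 1 is integrable, and t <= 1 + t^p for t >=
  0.\<close>

lemma integrable_if_powr_integrable:
  fixes f :: "'a \<Rightarrow> complex"
  assumes "finite_measure M" "1 \<le> p" "f \<in> borel_measurable M" "integrable M (\<lambda>x. norm (f x) powr p)"
  shows "integrable M f"
proof -
  interpret finite_measure M by fact
  have "norm (f x) \<le> norm (1 + norm (f x) powr p)" for x
  proof (cases "norm (f x) \<le> 1")
    case True
    then show ?thesis by (simp add: add_increasing2)
  next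
    case False
    then have "norm (f x) powr 1 \<le> norm (f x) powr p"
      using assms(2) by (intro powr_mono) auto
    then show ?thesis by simp
  qed
  moreover have "integrable M (\<lambda>x. 1 + norm (f x) powr p)"
    using assms by simp
  ultimately show ?thesis
    using assms(3) by (blast intro: Bochner_Integration.integrable_bound AE_I2)
qed

text \<open>Ensures that the numerator of a Rayleigh quotient is a genuine integral and not the
  default value 0 of a nonintegrable function. The majorant comes from |a + b| <= 2 max(|a|,
  |b|).\<close>

lemma integrable_powr_add:
  fixes f g :: "'a \<Rightarrow> complex"
  assumes "0 \<le> p" "f \<in> borel_measurable M" "g \<in> borel_measurable M"
    and "integrable M (\<lambda>x. norm (f x) powr p)" "integrable M (\<lambda>x. norm (g x) powr p)"
  shows "integrable M (\<lambda>x. norm (f x + g x) powr p)"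
proof (rule Bochner_Integration.integrable_bound)
  show "integrable M (\<lambda>x. 2 powr p * (norm (f x) powr p + norm (g x) powr p))"
    using assms by simp
  show "(\<lambda>x. norm (f x + g x) powr p) \<in> borel_measurable M"
    using assms(2,3) by measurable
  have "norm (f x + g x) powr p \<le> 2 powr p * (norm (f x) powr p + norm (g x) powr p)" for x
  proof -
    have "norm (f x + g x) \<le> 2 * max (norm (f x)) (norm (g x))"
      using norm_triangle_ineq[of "f x" "g x"] by linarith
    then have "norm (f x + g x) powr p \<le> (2 * max (norm (f x)) (norm (g x))) powr p"
      using assms(1) by (intro powr_mono2) auto
    also have "\<dots> = 2 powr p * max (norm (f x)) (norm (g x)) powr p"
      by (simp add: powr_mult)
    also have "\<dots> \<le> 2 powr p * (norm (f x) powr p + norm (g x) powr p)"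
      by (intro mult_left_mono) (auto simp: max_def)
    finally show ?thesis .
  qed
  then show "AE x in M. norm (norm (f x + g x) powr p)
      \<le> norm (2 powr p * (norm (f x) powr p + norm (g x) powr p))"
    by (intro AE_I2) auto
qed

section \<open>The sine and the distance to the integers\<close>

text \<open>The sine is concave on [0, pi], hence lies above its chord from 0 to pi/2; the point pi
  \<theta> has parameter 2 \<theta> on that chord.\<close>

lemma sin_ge_chord:
  assumes "0 \<le> \<theta>" "\<theta> \<le> 1 / 2"
  shows "2 * \<theta> \<le> sin (pi * \<theta>)"
proof -
  have "concave_on {0..pi} sin"
    by (rule f''_le0_imp_concave[where f' = cos and f'' = "\<lambda>x. - sin x"])
      (auto intro!: derivative_eq_intros sin_ge_zero)
  from concave_onD[OF this, of "2 * \<theta>" 0 "pi / 2"] assms show ?thesis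
    by (simp add: mult.commute)
qed

text \<open>The infimum is attained at the rounded value. This gives both the bound 1/2 on the
  distance and the frequency of the exponential that realises the upper bound.\<close>

lemma infdist_Ints_round: "infdist (\<beta>::real) \<int> = \<bar>\<beta> - of_int (round \<beta>)\<bar>"
proof (rule antisym)
  show "infdist \<beta> \<int> \<le> \<bar>\<beta> - of_int (round \<beta>)\<bar>"
    using infdist_le[of "of_int (round \<beta>)" \<int> \<beta>] by (simp add: dist_real_def)
  have "\<bar>\<beta> - of_int (round \<beta>)\<bar> \<le> dist \<beta> a" if "a \<in> \<int>" for a
    using that round_diff_minimal by (auto simp: dist_real_def elim!: Ints_cases)
  then show "\<bar>\<beta> - of_int (round \<beta>)\<bar> \<le> infdist \<beta> \<int>"
    using Ints_0 by (subst infdist_notempty) (auto intro!: cINF_greatest)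
qed

text \<open>The modulus of the sine is even and has period pi, so only the distance of \<beta> from
  the nearest integer counts; the sine is nonnegative on [0, pi].\<close>

lemma abs_sin_pi_eq_sin_infdist: "\<bar>sin (pi * \<beta>)\<bar> = sin (pi * infdist \<beta> \<int>)"
proof -
  define d where "d = \<beta> - of_int (round \<beta>)"
  have "sin (pi * \<beta>) = sin (pi * d + pi * of_int (round \<beta>))"
    by (simp add: d_def algebra_simps)
  also have "\<bar>\<dots>\<bar> = \<bar>sin (pi * d)\<bar>"
    by (cases "even (round \<beta>)") (simp_all add: sin_add abs_mult)
  also have "\<dots> = \<bar>sin (pi * \<bar>d\<bar>)\<bar>"
    by (cases "0 \<le> d") simp_all
  also have "\<dots> = sin (pi * \<bar>d\<bar>)"
  proof (intro abs_of_nonneg sin_ge_zero)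
    have "\<bar>d\<bar> \<le> 1"
      using of_int_round_abs_le[of \<beta>] by (simp add: d_def abs_minus_commute)
    then show "pi * \<bar>d\<bar> \<le> pi"
      by (simp add: mult_left_le)
  qed simp
  finally show ?thesis
    by (simp add: infdist_Ints_round d_def)
qed

section \<open>Bounds for the Rayleigh quotients\<close>

text \<open>By the product rule the gauge transform has weak derivative \<open>h\<close>, which is
  \<open>g + \<i> \<beta> u\<close> times a factor of modulus 1. Increments need pointwise values,
  hence the continuous representative \<open>w\<close>; inside integrals it may be exchanged for
  \<open>u\<close>.\<close>

lemma gauge_increment_bound:
  fixes u g w :: "real \<Rightarrow> complex" and \<beta> :: real
  defines "v \<equiv> \<lambda>t. w t * exp (\<i> * of_real \<beta> * of_real t)"
  assumes u: "integrable (lebesgue_on {a<..<b}) u" and g: "integrable (lebesgue_on {a<..<b}) g"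
    and weak: "has_weak_derivative_on u g {a<..<b}"
    and w: "continuous_on {a..b} w" and wu: "AE x in lebesgue_on {a<..<b}. w x = u x"
    and xy: "a < x" "x \<le> y" "y < b"
  shows "norm (v y - v x) \<le>
    (LINT t|lebesgue_on {a<..<b}. norm (g t + \<i> * of_real \<beta> * u t) * indicator {x<..y} t)"
proof -
  let ?M = "lebesgue_on {a<..<b}"
  define c where "c = \<i> * complex_of_real \<beta>"
  define e where "e t = exp (c * of_real t)" for t :: real
  define e' where "e' t = c * exp (c * of_real t)" for t :: real
  define h where "h t = g t * e t + u t * e' t" for t
  have e: "smooth_fun e" "\<And>x. (e has_vector_derivative e' x) (at x)"
    unfolding e_def e'_def by (rule smooth_fun_exp_linear has_vector_derivative_exp_linear)+
  have cont: "continuous_on A e" "continuous_on A e'" for A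
    unfolding e_def e'_def by (intro continuous_intros)+
  have v: "v = (\<lambda>t. w t * e t)"
    by (simp add: v_def e_def c_def)
  have "v y - v x = (LINT t|?M. h t * of_real (indicator {x<..y} t))"
  proof (rule weak_derivative_imp_increment[OF _ _ _ xy])
    show "continuous_on {a..b} v"
      unfolding v by (intro continuous_on_mult w cont)
    show "integrable ?M h"
      unfolding h_def
      by (intro Bochner_Integration.integrable_add integrable_mult_continuous u g cont)
    fix \<phi> assume \<phi>: "test_fun {a<..<b} \<phi>"
    have \<phi>'_cont: "continuous_on A (\<lambda>t. vector_derivative \<phi> (at t))" for A
      using \<phi> unfolding test_fun_def
      by (intro smooth_fun_continuous_on smooth_fun_vector_derivative) auto
    have "(LINT t|?M. v t * vector_derivative \<phi> (at t)) =
        (LINT t|?M. u t * e t * vector_derivative \<phi> (at t))"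
      unfolding v
    proof (rule integral_cong_AE)
      show "(\<lambda>t. w t * e t * vector_derivative \<phi> (at t)) \<in> borel_measurable ?M"
        by (intro borel_measurable_integrable integrable_mult_continuous
            continuous_imp_integrable_open_interval w cont \<phi>'_cont)
      show "(\<lambda>t. u t * e t * vector_derivative \<phi> (at t)) \<in> borel_measurable ?M"
        by (intro borel_measurable_integrable integrable_mult_continuous u cont \<phi>'_cont)
      show "AE t in ?M. w t * e t * vector_derivative \<phi> (at t) = u t * e t * vector_derivative \<phi> (at t)"
        using wu by eventually_elim simp
    qed
    also have "\<dots> = - (LINT t|?M. h t * \<phi> t)"
      unfolding h_def by (rule weak_derivative_mult_smooth[OF u g weak e cont(2) \<phi>])
    finally show "(LINT t|?M. v t * vector_derivative \<phi> (at t)) = - (LINT t|?M. h t * \<phi> t)" .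
  qed
  also have "norm \<dots> \<le> (LINT t|?M. norm (h t * of_real (indicator {x<..y} t)))"
    by (rule integral_norm_bound)
  also have "\<dots> = (LINT t|?M. norm (g t + c * u t) * indicator {x<..y} t)"
  proof -
    have "norm (h t) = norm (g t + c * u t)" for t
    proof -
      have "h t = (g t + c * u t) * e t"
        by (simp add: h_def e_def e'_def algebra_simps)
      then show ?thesis
        by (simp add: norm_mult e_def c_def norm_exp_eq_Re)
    qed
    then show ?thesis
      by (simp add: norm_mult)
  qed
  finally show ?thesis
    by (simp add: c_def)
qed

text \<open>The increments from 0 to x and from x to 2 pi run over disjoint intervals, so the sum of
  their moduli is at most the full integral. Periodicity of \<open>w\<close> turns this into a bound
  on \<open>v x\<close> itself.\<close>

lemma periodic_pointwise_bound:
  fixes u g w :: "real \<Rightarrow> complex"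
  assumes u: "integrable (lebesgue_on {0<..<2*pi}) u" and g: "integrable (lebesgue_on {0<..<2*pi}) g"
    and weak: "has_weak_derivative_on u g {0<..<2*pi}"
    and w: "continuous_on {0..2*pi} w" and wu: "AE x in lebesgue_on {0<..<2*pi}. w x = u x"
    and w_eq: "w 0 = w (2*pi)"
    and x: "0 < x" "x < 2 * pi"
  shows "2 * \<bar>sin (pi * \<beta>)\<bar> * norm (w x) \<le>
    (LINT t|lebesgue_on {0<..<2*pi}. norm (g t + \<i> * of_real \<beta> * u t))"
proof -
  let ?M = "lebesgue_on {0<..<2*pi}"
  define f where "f t = norm (g t + \<i> * of_real \<beta> * u t)" for t
  define v where "v t = w t * exp (\<i> * of_real \<beta> * of_real t)" for t
  define F where "F = (LINT t|?M. f t)"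
  have f: "integrable ?M f"
    unfolding f_def using u g by simp
  have incr: "norm (v t - v s) \<le> (LINT r|?M. f r * indicator {s<..t} r)"
    if "0 < s" "s \<le> t" "t < 2 * pi" for s t
    unfolding v_def f_def by (rule gauge_increment_bound[OF u g weak w wu that])
  have f_ind: "integrable ?M (\<lambda>r. f r * indicator {s<..t} r)"
    if "0 < s" "s \<le> t" "t < 2 * pi" for s t
    using that by (intro integrable_real_mult_indicator f) (auto simp: sets_restrict_space_iff)
  have inner: "norm (v x - v s) + norm (v t - v x) \<le> F" if "0 < s" "s < x" "x < t" "t < 2 * pi" for s t
  proof -
    have "norm (v x - v s) + norm (v t - v x) \<le>
        (LINT r|?M. f r * indicator {s<..x} r) + (LINT r|?M. f r * indicator {x<..t} r)"
      using that x by (intro add_mono incr) auto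
    also have "\<dots> = (LINT r|?M. f r * indicator {s<..x} r + f r * indicator {x<..t} r)"
      using that x by (intro Bochner_Integration.integral_add[symmetric] f_ind) auto
    also have "\<dots> \<le> F"
      unfolding F_def
    proof (rule integral_mono)
      show "integrable ?M (\<lambda>r. f r * indicator {s<..x} r + f r * indicator {x<..t} r)"
        using that x by (intro Bochner_Integration.integrable_add f_ind) auto
      \<comment> \<open>The two intervals are disjoint, so at most one indicator is 1 and both
        increments together cost a single \<open>F\<close>.\<close>
      show "f r * indicator {s<..x} r + f r * indicator {x<..t} r \<le> f r" for r
        by (auto simp: indicator_def f_def)
    qed (rule f)
    finally show ?thesis .
  qed
  have v: "continuous_on {0..2*pi} v"
    unfolding v_def by (intro continuous_intros w)
  have v_right: "(v \<longlongrightarrow> v 0) (at_right 0)" and v_left: "(v \<longlongrightarrow> v (2 * pi)) (at_left (2 * pi))"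
    using continuous_on_Icc_at_rightD[OF v] continuous_on_Icc_at_leftD[OF v] by auto
  \<comment> \<open>Increments are controlled only between interior points, so the endpoints are
    reached by continuity of \<open>v\<close>: first s tends to 0, then t to 2 pi.\<close>
  have "norm (v x - v 0) + norm (v t - v x) \<le> F" if "x < t" "t < 2 * pi" for t
  proof (rule tendsto_upperbound)
    show "((\<lambda>s. norm (v x - v s) + norm (v t - v x)) \<longlongrightarrow> norm (v x - v 0) + norm (v t - v x)) (at_right 0)"
      by (intro tendsto_intros v_right)
    show "\<forall>\<^sub>F s in at_right 0. norm (v x - v s) + norm (v t - v x) \<le> F"
      using eventually_at_right_less[of 0] eventually_at_right[of 0 x] x inner that
      by (metis (mono_tags, lifting) eventually_at_rightI greaterThanLessThan_iff)
  qed simp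
  then have outer: "norm (v x - v 0) + norm (v (2 * pi) - v x) \<le> F"
  proof (intro tendsto_upperbound)
    show "((\<lambda>t. norm (v x - v 0) + norm (v t - v x)) \<longlongrightarrow>
        norm (v x - v 0) + norm (v (2 * pi) - v x)) (at_left (2 * pi))"
      by (intro tendsto_intros v_left)
    show "\<forall>\<^sub>F t in at_left (2 * pi). norm (v x - v 0) + norm (v t - v x) \<le> F"
      if *: "\<And>t. x < t \<Longrightarrow> t < 2 * pi \<Longrightarrow> norm (v x - v 0) + norm (v t - v x) \<le> F"
      using x * by (intro eventually_at_leftI[of x]) auto
  qed simp
  define \<omega> where "\<omega> = exp (\<i> * complex_of_real (2 * pi * \<beta>))"
  have "v (2 * pi) = \<omega> * v 0"
    using w_eq by (simp add: v_def \<omega>_def mult_ac)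
  then have "(\<omega> - 1) * v x = \<omega> * (v x - v 0) + (v (2 * pi) - v x)"
    by (simp add: algebra_simps)
  then have "norm (\<omega> - 1) * norm (v x) \<le> norm (\<omega> * (v x - v 0)) + norm (v (2 * pi) - v x)"
    by (metis norm_mult norm_triangle_ineq)
  also have "\<dots> \<le> F"
    using outer by (simp add: norm_mult \<omega>_def)
  finally have "norm (\<omega> - 1) * norm (v x) \<le> F" .
  \<comment> \<open>The length of the chord of the unit circle that subtends the angle 2 pi
    \<beta>.\<close>
  moreover have "norm (\<omega> - 1) = 2 * \<bar>sin (pi * \<beta>)\<bar>"
    unfolding \<omega>_def dist_exp_i_1 by simp
  moreover have "norm (v x) = norm (w x)"
    by (simp add: v_def norm_mult norm_exp_eq_Re)
  ultimately show ?thesis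
    by (simp add: F_def f_def)
qed

text \<open>Dividing the pointwise bound by 2 pi compares \<open>norm (w x)\<close> with the mean
  \<open>F / (2 * pi)\<close> of \<open>f\<close>, which is exactly the quantity whose p-th power
  Jensen's inequality bounds.\<close>

lemma rayleigh_quotient_lower_bound:
  assumes p: "1 < p" and q: "q \<in> rayleigh_quotients \<beta> p"
  shows "(sin (pi * infdist \<beta> \<int>) / pi) powr p \<le> q"
proof -
  let ?M = "lebesgue_on {0<..<2*pi}"
  interpret finite_measure ?M
    by (rule finite_measure_lebesgue_on_Ioo)
  obtain u g where q: "q = (LINT x|?M. norm (g x + \<i> * of_real \<beta> * u x) powr p) /
      (LINT x|?M. norm (u x) powr p)"
    and "u \<in> W1p p {0<..<2*pi}" "g \<in> Lp_fun p {0<..<2*pi}"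
    and weak: "has_weak_derivative_on u g {0<..<2*pi}"
    and nz: "\<not> (AE x in ?M. u x = 0)" and "equal_boundary_values 0 (2*pi) u"
    using q unfolding rayleigh_quotients_def by blast
  then have um: "u \<in> borel_measurable ?M" and up: "integrable ?M (\<lambda>x. norm (u x) powr p)"
    and gm: "g \<in> borel_measurable ?M" and gp: "integrable ?M (\<lambda>x. norm (g x) powr p)"
    by (auto simp: W1p_def Lp_fun_def)
  obtain w where w: "continuous_on {0..2*pi} w" and wu: "AE x in ?M. w x = u x" and w_eq: "w 0 = w (2*pi)"
    using \<open>equal_boundary_values 0 (2*pi) u\<close> unfolding equal_boundary_values_def by blast
  have u: "integrable ?M u" and g: "integrable ?M g"
    using p by (auto intro!: integrable_if_powr_integrable finite_measure_axioms um up gm gp less_imp_le)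
  define f where "f x = norm (g x + \<i> * of_real \<beta> * u x)" for x
  define s where "s = \<bar>sin (pi * \<beta>)\<bar>"
  define F where "F = (LINT x|?M. f x)"
  have f: "integrable ?M f"
    unfolding f_def using u g by simp
  have "integrable ?M (\<lambda>x. norm (\<i> * of_real \<beta> * u x) powr p)"
    using up by (simp add: norm_mult powr_mult)
  then have fp: "integrable ?M (\<lambda>x. f x powr p)"
    unfolding f_def using p um gm gp by (intro integrable_powr_add) auto
  have F: "0 \<le> F"
    unfolding F_def f_def by (simp add: integral_nonneg_AE)
  have space: "measure ?M (space ?M) = 2 * pi"
    by (simp add: measure_restrict_space)
  have "(s / pi) powr p * (LINT x|?M. norm (u x) powr p) = (LINT x|?M. (s / pi) powr p * norm (u x) powr p)"
    by simp
  also have "\<dots> \<le> (LINT x|?M. (F / (2 * pi)) powr p)"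
  proof (rule integral_mono_AE)
    have "(s / pi) powr p * norm (w x) powr p \<le> (F / (2 * pi)) powr p" if "x \<in> {0<..<2*pi}" for x
    proof -
      have "2 * s * norm (w x) \<le> F"
        unfolding s_def F_def f_def using that
        by (intro periodic_pointwise_bound u g weak w wu w_eq) auto
      then have "s / pi * norm (w x) \<le> F / (2 * pi)"
        by (simp add: field_simps)
      then have "(s / pi * norm (w x)) powr p \<le> (F / (2 * pi)) powr p"
        using p by (intro powr_mono2) (auto simp: s_def)
      then show ?thesis
        by (simp only: powr_mult)
    qed
    then have "AE x in ?M. (s / pi) powr p * norm (w x) powr p \<le> (F / (2 * pi)) powr p"
      by (intro AE_I2) auto
    then show "AE x in ?M. (s / pi) powr p * norm (u x) powr p \<le> (F / (2 * pi)) powr p"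
      using wu by eventually_elim simp
  qed (use up in auto)
  also have "\<dots> = 2 * pi * (F / (2 * pi)) powr p"
    using space by simp
  also have "\<dots> \<le> (LINT x|?M. f x powr p)"
    unfolding F_def
    by (rule Jensen_powr[OF finite_measure_axioms p f _ fp space[symmetric]]) (auto simp: f_def)
  finally have main: "(s / pi) powr p * (LINT x|?M. norm (u x) powr p) \<le> (LINT x|?M. f x powr p)" .
  \<comment> \<open>A nonnegative integrable function with integral 0 vanishes almost everywhere,
    which is excluded for \<open>u\<close>.\<close>
  have "(LINT x|?M. norm (u x) powr p) \<noteq> 0"
    using nz integral_nonneg_eq_0_iff_AE[OF up] by simp
  moreover have "0 \<le> (LINT x|?M. norm (u x) powr p)"
    by (simp add: integral_nonneg_AE)
  ultimately have "0 < (LINT x|?M. norm (u x) powr p)"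
    by linarith
  then have "(s / pi) powr p \<le> q"
    using main unfolding q f_def by (simp only: pos_le_divide_eq)
  then show ?thesis
    by (simp add: s_def abs_sin_pi_eq_sin_infdist)
qed

section \<open>The exponential that gives the upper bound\<close>

text \<open>Classical integration by parts: the boundary terms disappear because test functions
  vanish at both endpoints.\<close>

lemma smooth_has_weak_derivative_on:
  assumes e: "smooth_fun e" "\<And>x. (e has_vector_derivative e' x) (at x)" "continuous_on UNIV e'"
    and ab: "a \<le> b"
  shows "has_weak_derivative_on e e' {a<..<b}"
  unfolding has_weak_derivative_on_def
proof (intro conjI allI impI)
  fix K assume K: "compact K \<and> K \<subseteq> {a<..<b}"
  then have "K \<in> sets lebesgue" "K \<subseteq> {a..b}"
    by (auto simp: borel_compact)
  then show "e absolutely_integrable_on K" "e' absolutely_integrable_on K"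
    using e smooth_fun_continuous_on continuous_on_subset[OF _ subset_UNIV]
    by (meson absolutely_integrable_continuous_real set_integrable_subset)+
next
  fix \<phi> assume \<phi>: "test_fun {a<..<b} \<phi>"
  let ?M = "lebesgue_on {a<..<b}"
  define \<phi>' where "\<phi>' t = vector_derivative \<phi> (at t)" for t
  have smooth: "smooth_fun \<phi>" and supp: "closure {x. \<phi> x \<noteq> 0} \<subseteq> {a<..<b}"
    using \<phi> by (auto simp: test_fun_def)
  have \<phi>': "(\<phi> has_vector_derivative \<phi>' t) (at t)" for t
    unfolding \<phi>'_def by (rule smooth_fun_has_vector_derivative[OF smooth])
  have cont: "continuous_on A e" "continuous_on A \<phi>" "continuous_on A \<phi>'" "continuous_on A e'" for A
    unfolding \<phi>'_def
    using smooth e smooth_fun_vector_derivative smooth_fun_continuous_on continuous_on_subset by blast+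
  have zero: "\<phi> a = 0" "\<phi> b = 0"
    using subset_trans[OF closure_subset supp] by auto
  have "((\<lambda>t. e t * \<phi>' t + e' t * \<phi> t) has_integral (e b * \<phi> b - e a * \<phi> a)) {a..b}"
    by (rule fundamental_theorem_of_calculus[OF ab
          has_vector_derivative_at_within[OF has_vector_derivative_mult[OF e(2) \<phi>']]])
  then have "integral {a<..<b} (\<lambda>t. e t * \<phi>' t + e' t * \<phi> t) = 0"
    by (simp add: zero has_integral_Icc_iff_Ioo integral_unique)
  moreover have i1: "integrable ?M (\<lambda>t. e t * \<phi>' t)" and i2: "integrable ?M (\<lambda>t. e' t * \<phi> t)"
    by (intro continuous_imp_integrable_open_interval continuous_on_mult cont)+
  ultimately have "(LINT t|?M. e t * \<phi>' t + e' t * \<phi> t) = 0"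
    by (subst lebesgue_integral_eq_integral) auto
  then have "(LINT t|?M. e t * \<phi>' t) + (LINT t|?M. e' t * \<phi> t) = 0"
    using i1 i2 by simp
  then show "(LINT t|?M. e t * vector_derivative \<phi> (at t)) = - (LINT t|?M. e' t * \<phi> t)"
    unfolding \<phi>'_def by (simp add: eq_neg_iff_add_eq_0)
qed

lemma infdist_powr_in_rayleigh_quotients:
  assumes "1 < p"
  shows "infdist \<beta> \<int> powr p \<in> rayleigh_quotients \<beta> p"
proof -
  let ?M = "lebesgue_on {0<..<2*pi}"
  interpret finite_measure ?M
    by (rule finite_measure_lebesgue_on_Ioo)
  define n where "n = round \<beta>"
  define c where "c = - \<i> * complex_of_int n"
  define u where "u x = exp (c * of_real x)" for x :: real
  define g where "g x = c * u x" for x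
  have norm_u: "norm (u x) = 1" for x
    by (simp add: u_def c_def norm_exp_eq_Re)
  have cont: "continuous_on A u" "continuous_on A g" for A
    unfolding u_def g_def by (intro continuous_intros)+
  have meas: "u \<in> borel_measurable ?M" "g \<in> borel_measurable ?M"
    by (intro borel_measurable_integrable continuous_imp_integrable_open_interval cont)+
  have Lp: "u \<in> Lp_fun p {0<..<2*pi}" "g \<in> Lp_fun p {0<..<2*pi}"
    using meas by (auto simp: Lp_fun_def g_def norm_mult norm_u)
  have weak: "has_weak_derivative_on u g {0<..<2*pi}"
    by (intro smooth_has_weak_derivative_on cont)
      (auto simp: u_def[abs_def] g_def smooth_fun_exp_linear has_vector_derivative_exp_linear)
  have space: "measure ?M (space ?M) = 2 * pi"
    by (simp add: measure_restrict_space)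
  \<comment> \<open>The twisted derivative multiplies \<open>u\<close> by \<i> (\<beta> - n). Both
    integrands of the quotient are therefore constant and the length 2 pi cancels.\<close>
  have "norm (g x + \<i> * of_real \<beta> * u x) = infdist \<beta> \<int>" for x
  proof -
    have "g x + \<i> * of_real \<beta> * u x = \<i> * of_real (\<beta> - of_int n) * u x"
      by (simp add: g_def c_def algebra_simps)
    then show ?thesis
      by (simp add: norm_mult norm_u infdist_Ints_round n_def del: of_real_diff)
  qed
  then have "infdist \<beta> \<int> powr p = (LINT x|?M. norm (g x + \<i> * of_real \<beta> * u x) powr p) /
      (LINT x|?M. norm (u x) powr p)"
    using space by (simp add: norm_u)
  moreover have "u \<in> W1p p {0<..<2*pi}"
    using Lp weak by (auto simp: W1p_def)
  moreover have "\<not> (AE x in ?M. u x = 0)"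
  proof
    assume "AE x in ?M. u x = 0"
    then have "AE x in ?M. False"
      by eventually_elim (use norm_u in \<open>metis norm_zero zero_neq_one\<close>)
    then have "emeasure ?M (space ?M) = 0"
      using AE_iff_measurable[OF sets.top[of ?M], of "\<lambda>_. False"] by blast
    then show False
      using space by (simp add: measure_def)
  qed
  moreover have "u 0 = u (2 * pi)"
  proof -
    have "u (2 * pi) = exp (complex_of_real (2 * of_int (- n) * pi) * \<i>)"
      by (simp add: u_def c_def mult_ac)
    also have "\<dots> = 1"
      by (rule exp_integer_2pi) (rule Ints_of_int)
    finally show ?thesis by (simp add: u_def)
  qed
  then have "equal_boundary_values 0 (2*pi) u"
    unfolding equal_boundary_values_def using cont(1) by blast
  ultimately show ?thesis
    unfolding rayleigh_quotients_def using Lp weak by blast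
qed

theorem theorem1p2:
  fixes p \<beta> \<theta> :: real
  assumes "1 < p"
    and "\<theta> = infdist \<beta> \<int>"
  shows "\<theta> \<in> {0..1/2} \<and>
    (sin (pi * \<theta>) / pi) powr p \<le> lambda_inf \<beta> p \<and>
    lambda_inf \<beta> p \<le> \<theta> powr p \<and>
    (2 / pi) powr p * infdist \<beta> \<int> powr p \<le> lambda_inf \<beta> p \<and>
    lambda_inf \<beta> p \<le> infdist \<beta> \<int> powr p"
proof -
  have \<theta>: "0 \<le> \<theta>" "\<theta> \<le> 1 / 2"
    using of_int_round_abs_le[of \<beta>] by (auto simp: assms(2) infdist_Ints_round abs_minus_commute)
  have lower: "(sin (pi * \<theta>) / pi) powr p \<le> q" if "q \<in> rayleigh_quotients \<beta> p" for q
    using rayleigh_quotient_lower_bound[OF assms(1) that] by (simp add: assms(2))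
  have mem: "\<theta> powr p \<in> rayleigh_quotients \<beta> p"
    using infdist_powr_in_rayleigh_quotients[OF assms(1)] by (simp add: assms(2))
  have 1: "(sin (pi * \<theta>) / pi) powr p \<le> lambda_inf \<beta> p"
    \<comment> \<open>The real infimum is meaningful only for a nonempty set that is bounded below:
      \<open>mem\<close> provides the first property, \<open>lower\<close> the second.\<close>
    unfolding lambda_inf_def using mem by (intro cInf_greatest lower) auto
  have 2: "lambda_inf \<beta> p \<le> \<theta> powr p"
    unfolding lambda_inf_def using lower by (intro cInf_lower mem bdd_belowI)
  \<comment> \<open>The linear bound weakens the sine bound through the chord estimate 2 \<theta> <=
    sin(pi \<theta>).\<close>
  have "(2 / pi) powr p * \<theta> powr p = (2 * \<theta> / pi) powr p"
    using \<theta> by (simp add: powr_mult[symmetric])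
  also have "\<dots> \<le> (sin (pi * \<theta>) / pi) powr p"
    using assms(1) \<theta> sin_ge_chord[OF \<theta>] by (intro powr_mono2 divide_right_mono) auto
  finally have 3: "(2 / pi) powr p * \<theta> powr p \<le> lambda_inf \<beta> p"
    using 1 by linarith
  show ?thesis
    using \<theta> 1 2 3 unfolding assms(2) by simp
qed

end
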